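(* Let $A\colon\mathbb{R}^+\to M(n,\mathbb{R})$ be continuous with $\sup_{t\in\mathbb{R}^+}\|A(t)\|=M>0$. Suppose that there are constants $K\ge 1$ and $\alpha>0$ such that the transition matrix $\Phi(t,s)$ of $\dot x=A(t)x$ satisfies $\|\Phi(t,s)\|\le Ke^{-\alpha(t-s)}$ for all $t\ge s\ge 0$. Let $f\colon\mathbb{R}^+\times\mathbb{R}^n\to\mathbb{R}^n$ be continuous and suppose that there are constants $\gamma,\mu\geq 0$ such that $|f(t,y)-f(t,\bar y)|\le\gamma|y-\bar y|$ and $|f(t,y)|\le\mu$ for all $t\ge 0$ and $y,\bar y\in\mathbb{R}^n$. Assume that $\frac{K\gamma}{\alpha}<1$. If $f(t,0)=0$ for any $t\ge 0$, then the origin is a globally uniformly asymptotically stable solution of $\dot y=A(t)y+f(t,y)$.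
   Context: $\mathbb{R}^+=[0,+\infty)$; $M(n,\mathbb{R})$ is the space of real $n\times n$ matrices; $|\cdot|$ is a vector norm on $\mathbb{R}^n$ and $\|\cdot\|$ a matrix norm compatible with it ($|Bv|\le\|B\||v|$). The transition matrix $\Phi(t,s)$ is the solution of $\partial_t\Phi(t,s)=A(t)\Phi(t,s)$, $\Phi(s,s)=I$. Write $t\mapsto y(t,t_0,\eta)$ for the solution of $\dot y=A(t)y+f(t,y)$ with $y(t_0,t_0,\eta)=\eta$. The origin is globally uniformly asymptotically stable if it is uniformly stable (for every $\varepsilon>0$ there is $\delta>0$, independent of $t_0$, such that $|\eta|<\delta$ implies $|y(t,t_0,\eta)|<\varepsilon$ for all $t\ge t_0\ge 0$) and for every $\varepsilon>0$ and $c>0$ there is $T=T(\varepsilon,c)>0$ such that $|y(t,t_0,\eta)|<\varepsilon$ for all $t_0\ge 0$, all $t>t_0+T$ and all $|\eta|<c$. *)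

theory Defs
  imports "HOL-Analysis.Analysis"
begin

(* An arbitrary norm on a real vector space, in general different from the
   type-class norm (which on real ^ 'n is the Euclidean one). *)
definition is_norm :: "('a::real_vector \<Rightarrow> real) \<Rightarrow> bool" where
  "is_norm N \<longleftrightarrow>
     (\<forall>x. 0 \<le> N x) \<and> (\<forall>x. N x = 0 \<longleftrightarrow> x = 0) \<and>
     (\<forall>c x. N (c *\<^sub>R x) = \<bar>c\<bar> * N x) \<and>
     (\<forall>x y. N (x + y) \<le> N x + N y)"

definition compatible_norms ::
    "(real ^ 'n \<Rightarrow> real) \<Rightarrow> (real ^ 'n ^ 'n \<Rightarrow> real) \<Rightarrow> bool" where
  "compatible_norms N MN \<longleftrightarrow> (\<forall>B v. N (B *v v) \<le> MN B * N v)"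

(* The derivative at the left end point t0 is one-sided. *)
definition solves_ivp ::
    "(real \<Rightarrow> 'a::real_normed_vector \<Rightarrow> 'a) \<Rightarrow> real \<Rightarrow> 'a \<Rightarrow> (real \<Rightarrow> 'a) \<Rightarrow> bool" where
  "solves_ivp F t0 \<eta> y \<longleftrightarrow>
     y t0 = \<eta> \<and>
     (\<forall>t\<ge>t0. (y has_vector_derivative F t (y t)) (at t within {t0..}))"

(* The value at time t of the solution of y' = F t y, y t0 = \<eta>, on [t0, \<infinity>).
   The description picks the value rather than the function, since a solution is
   not determined outside [t0, \<infinity>).  It is meaningful for t \<ge> t0 whenever the
   initial value problem has exactly one solution on [t0, \<infinity>). *)
definition ivp_solution ::
    "(real \<Rightarrow> 'a::real_normed_vector \<Rightarrow> 'a) \<Rightarrow> real \<Rightarrow> real \<Rightarrow> 'a \<Rightarrow> 'a" where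
  "ivp_solution F t t0 \<eta> = (THE v. \<exists>y. solves_ivp F t0 \<eta> y \<and> y t = v)"

definition transition_matrix ::
    "(real \<Rightarrow> real ^ 'n ^ 'n) \<Rightarrow> real \<Rightarrow> real \<Rightarrow> real ^ 'n ^ 'n" where
  "transition_matrix A t s = ivp_solution (\<lambda>t X. A t ** X) t s (mat 1)"

definition origin_uniformly_stable ::
    "('a::real_normed_vector \<Rightarrow> real) \<Rightarrow> (real \<Rightarrow> 'a \<Rightarrow> 'a) \<Rightarrow> bool" where
  "origin_uniformly_stable N F \<longleftrightarrow>
     (\<forall>\<epsilon>>0. \<exists>\<delta>>0. \<forall>t0\<ge>0. \<forall>\<eta>. N \<eta> < \<delta> \<longrightarrow>
        (\<forall>t\<ge>t0. N (ivp_solution F t t0 \<eta>) < \<epsilon>))"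

definition origin_globally_uniformly_asymptotically_stable ::
    "('a::real_normed_vector \<Rightarrow> real) \<Rightarrow> (real \<Rightarrow> 'a \<Rightarrow> 'a) \<Rightarrow> bool" where
  "origin_globally_uniformly_asymptotically_stable N F \<longleftrightarrow>
     origin_uniformly_stable N F \<and>
     (\<forall>\<epsilon>>0. \<forall>c>0. \<exists>T>0. \<forall>t0\<ge>0. \<forall>t>t0 + T. \<forall>\<eta>. N \<eta> < c \<longrightarrow>
        N (ivp_solution F t t0 \<eta>) < \<epsilon>)"

end

theory Submission
  imports Defs
begin

text \<open>The linear part contracts at rate \<open>\<alpha>\<close>, up to the factor \<open>K\<close>, and the perturbation,
  which vanishes at the origin and is \<open>\<gamma>\<close>-Lipschitz, can spoil at most \<open>K * \<gamma>\<close> of that rate. By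
  variation of constants a solution of \<open>y' = A t y + f t y\<close> satisfies
  \<open>y t = \<Phi> t t0 \<eta> + \<integral> \<Phi> t s (f s (y s)) ds\<close>, hence
  \<open>|y t| \<le> K e^(- \<alpha> (t - t0)) |\<eta>| + \<integral> K \<gamma> e^(- \<alpha> (t - s)) |y s| ds\<close>. Multiplying by
  \<open>e^(\<alpha> (t - t0))\<close> and applying Gronwall's inequality gives
  \<open>|y t| \<le> K e^(- (\<alpha> - K \<gamma>) (t - t0)) |\<eta>|\<close>. The exponent is negative because
  \<open>K * \<gamma> < \<alpha>\<close>, and both halves of stability can be read off from this bound, which is uniform
  in \<open>t0\<close> (lemma \<open>perturbed_linear_decay\<close>).

  Solutions are given by a definite description, so for the argument to say anything about them
  the initial value problems for \<open>y\<close> and for \<open>\<Phi>\<close> must have exactly one solution on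
  \<open>[t0, \<infinity>)\<close>. Both right-hand sides vanish at the origin and are Lipschitz uniformly in time,
  because \<open>A\<close> is bounded; existence on the whole half line is then a contraction argument in an
  exponentially weighted sup norm (\<open>lipschitz_ivp_solvable\<close>) and uniqueness is Gronwall's
  inequality (\<open>solves_ivp_unique\<close>). Finally, the norm \<open>|.|\<close> is arbitrary, whereas derivatives and
  integrals live in the Euclidean norm; equivalence of norms (\<open>is_norm_equivalent\<close>) and the triangle
  inequality for integrals (\<open>is_norm_has_integral_le\<close>) bridge the two.\<close>

section \<open>Arbitrary norms on Euclidean spaces\<close>

lemma is_normD:
  assumes "is_norm N"
  shows "0 \<le> N x" "N x = 0 \<longleftrightarrow> x = 0" "N (c *\<^sub>R x) = \<bar>c\<bar> * N x" "N (x + y) \<le> N x + N y"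
  using assms unfolding is_norm_def by blast+

lemma is_norm_sum_le:
  assumes "is_norm N"
  shows "N (\<Sum>i\<in>S. g i) \<le> (\<Sum>i\<in>S. N (g i))"
proof (induction S rule: infinite_finite_induct)
  case (insert i S)
  then show ?case using is_normD(4)[OF assms, of "g i" "sum g S"] by simp
qed (use is_normD(2)[OF assms, of 0] in auto)

lemma is_norm_le_euclidean:
  fixes N :: "'a::euclidean_space \<Rightarrow> real"
  assumes "is_norm N"
  obtains C where "C > 0" "\<And>x. N x \<le> C * norm x"
proof
  let ?C = "1 + (\<Sum>b\<in>Basis. N b)"
  have nonneg: "0 \<le> (\<Sum>b\<in>Basis. N b)"
    by (intro sum_nonneg is_normD(1)[OF assms])
  then show "?C > 0" by simp
  fix x :: 'a
  have "N x = N (\<Sum>b\<in>Basis. (x \<bullet> b) *\<^sub>R b)"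
    by (simp add: euclidean_representation)
  also have "\<dots> \<le> (\<Sum>b\<in>Basis. N ((x \<bullet> b) *\<^sub>R b))"
    by (rule is_norm_sum_le[OF assms])
  also have "\<dots> = (\<Sum>b\<in>Basis. \<bar>x \<bullet> b\<bar> * N b)"
    by (simp add: is_normD(3)[OF assms])
  also have "\<dots> \<le> (\<Sum>b\<in>Basis. norm x * N b)"
    by (intro sum_mono mult_right_mono Basis_le_norm is_normD(1)[OF assms])
  also have "\<dots> \<le> ?C * norm x"
    by (simp add: sum_distrib_left[symmetric] distrib_right)
  finally show "N x \<le> ?C * norm x" .
qed

lemma is_norm_continuous_on:
  fixes N :: "'a::euclidean_space \<Rightarrow> real"
  assumes "is_norm N"
  shows "continuous_on S N"
proof -
  obtain C where C: "C > 0" "\<And>x. N x \<le> C * norm x"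
    using is_norm_le_euclidean[OF assms] by blast
  have diff: "N x - N y \<le> C * dist x y" for x y
    using is_normD(4)[OF assms, of "x - y" y] C(2)[of "x - y"] by (simp add: dist_norm)
  have "C-lipschitz_on S N"
  proof (rule lipschitz_onI)
    show "dist (N x) (N y) \<le> C * dist x y" for x y
      using diff[of x y] diff[of y x] by (auto simp: dist_real_def dist_commute)
  qed (use C in simp)
  then show ?thesis by (rule lipschitz_on_continuous_on)
qed

text \<open>The lower constant is the minimum over the unit sphere, attained by compactness.\<close>

lemma is_norm_equivalent:
  fixes N :: "'a::euclidean_space \<Rightarrow> real"
  assumes "is_norm N"
  obtains c C where "c > 0" "C > 0" "\<And>x. c * norm x \<le> N x" "\<And>x. N x \<le> C * norm x"
proof -
  obtain C where C: "C > 0" "\<And>x. N x \<le> C * norm x"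
    using is_norm_le_euclidean[OF assms] by blast
  obtain e :: 'a where "e \<in> sphere 0 1"
    using nonempty_Basis norm_Basis by fastforce
  then obtain p where p: "p \<in> sphere 0 1" and min: "\<And>x. x \<in> sphere 0 1 \<Longrightarrow> N p \<le> N x"
    using continuous_attains_inf[OF compact_sphere _ is_norm_continuous_on[OF assms], of 0 1]
    by blast
  have "N p > 0"
    using p is_normD(1,2)[OF assms, of p] by (auto simp: less_le)
  moreover have "N p * norm x \<le> N x" for x
  proof (cases "x = 0")
    case False
    then have "N p \<le> N ((1 / norm x) *\<^sub>R x)"
      by (intro min) simp
    then show ?thesis
      using False by (simp only: is_normD(3)[OF assms]) (simp add: field_simps)
  qed (simp add: is_normD(1)[OF assms])
  ultimately show thesis
    by (intro that[of "N p" C]) (use C in auto)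
qed

text \<open>The triangle inequality for integrals, by duality: the integral \<open>I\<close> is tested against a linear
  functional that separates a multiple of \<open>I\<close> from the unit ball of \<open>N\<close>, which reduces the claim
  to monotonicity of real integrals.\<close>

lemma is_norm_has_integral_le:
  fixes g :: "'b::euclidean_space \<Rightarrow> 'a::euclidean_space"
  assumes N: "is_norm N"
    and g: "(g has_integral I) S" and h: "(h has_integral J) S"
    and le: "\<And>s. s \<in> S \<Longrightarrow> N (g s) \<le> h s"
  shows "N I \<le> J"
proof (rule ccontr)
  assume "\<not> N I \<le> J"
  then obtain c where c: "J < c" "c < N I"
    using dense[of J "N I"] by auto
  have "0 \<le> J"
    by (rule has_integral_nonneg[OF h]) (rule order_trans[OF is_normD(1)[OF N] le])
  with c have "c > 0" by simp
  let ?B = "{z. N z \<le> 1}"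
  have "convex ?B"
  proof (rule convexI, safe)
    fix x y u v assume *: "N x \<le> 1" "N y \<le> 1" "0 \<le> u" "0 \<le> v" "u + v = (1::real)"
    have "N (u *\<^sub>R x + v *\<^sub>R y) \<le> u * N x + v * N y"
      using is_normD(4)[OF N, of "u *\<^sub>R x" "v *\<^sub>R y"] * by (simp add: is_normD(3)[OF N])
    also have "\<dots> \<le> u * 1 + v * 1"
      using * by (intro add_mono mult_left_mono) auto
    finally show "N (u *\<^sub>R x + v *\<^sub>R y) \<le> 1" using * by simp
  qed
  moreover have "closed ?B"
    by (intro closed_Collect_le continuous_on_const is_norm_continuous_on[OF N])
  moreover have "(1 / c) *\<^sub>R I \<notin> ?B"
    using c \<open>c > 0\<close> by (simp add: is_normD(3)[OF N])
  ultimately have "\<exists>a b. a \<bullet> ((1 / c) *\<^sub>R I) < b \<and> (\<forall>x\<in>?B. b < a \<bullet> x)"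
    by (rule separating_hyperplane_closed_point)
  then obtain a b where ab: "a \<bullet> ((1 / c) *\<^sub>R I) < b" "\<And>x. x \<in> ?B \<Longrightarrow> b < a \<bullet> x"
    by blast
  have "b < 0"
    using ab(2)[of 0] is_normD(2)[OF N, of 0] by simp
  have lower: "b * N v \<le> a \<bullet> v" for v
  proof (cases "v = 0")
    case False
    then have "N v > 0"
      using is_normD(1,2)[OF N, of v] by (auto simp: less_le)
    moreover from this have "b < a \<bullet> ((1 / N v) *\<^sub>R v)"
      by (intro ab(2)) (simp add: is_normD(3)[OF N])
    ultimately show ?thesis by (simp add: field_simps)
  qed (use is_normD(2)[OF N, of 0] in simp)
  have int_g: "((\<lambda>s. a \<bullet> g s) has_integral a \<bullet> I) S"
    using has_integral_linear[OF g bounded_linear_inner_right[of a]] by (simp add: o_def)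
  have int_h: "((\<lambda>s. b * h s) has_integral b * J) S"
    by (rule has_integral_mult_right[OF h])
  have "b * h s \<le> a \<bullet> g s" if "s \<in> S" for s
    using le[OF that] \<open>b < 0\<close> lower[of "g s"] mult_left_mono_neg[of "N (g s)" "h s" b] by linarith
  then have "b * J \<le> a \<bullet> I"
    by (rule has_integral_le[OF int_h int_g])
  also have "a \<bullet> I < b * c"
    using ab(1) \<open>c > 0\<close> by (simp add: field_simps)
  finally show False
    using c \<open>b < 0\<close> by simp
qed

section \<open>Initial value problems on a half line\<close>

lemma continuous_on_if_vector_derivative:
  assumes "\<And>t. t \<in> S \<Longrightarrow> (y has_vector_derivative y' t) (at t within S)"
  shows "continuous_on S y"
  using assms has_vector_derivative_continuous
  by (fastforce simp: continuous_on_eq_continuous_within)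

lemma integral_has_vector_derivative_atLeast:
  fixes g :: "real \<Rightarrow> 'a::banach"
  assumes "continuous_on {a..} g" "a \<le> t"
  shows "((\<lambda>u. integral {a..u} g) has_vector_derivative g t) (at t within {a..})"
proof -
  have "((\<lambda>u. integral {a..u} g) has_vector_derivative g t) (at t within {a..t + 1})"
    using assms by (intro integral_has_vector_derivative) (auto intro: continuous_on_subset)
  also have "at t within {a..t + 1} = at t within {a..}"
    by (rule at_within_nhd[of _ "{..<t + 1}"]) auto
  finally show ?thesis .
qed

lemma gronwall:
  fixes u :: "real \<Rightarrow> real"
  assumes cont: "continuous_on {a..} u" and "b \<ge> 0"
    and le: "\<And>t. a \<le> t \<Longrightarrow> u t \<le> C + b * integral {a..t} u"
    and "a \<le> t"
  shows "u t \<le> C * exp (b * (t - a))"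
proof -
  let ?V = "\<lambda>t. C + b * integral {a..t} u"
  let ?W = "\<lambda>t. ?V t * exp (- b * (t - a))"
  have dI: "((\<lambda>t. integral {a..t} u) has_real_derivative u s) (at s within {a..})"
    if "a \<le> s" for s
    using integral_has_vector_derivative_atLeast[OF cont that]
    by (simp add: has_real_derivative_iff_has_vector_derivative)
  have dW: "(?W has_real_derivative b * (u s - ?V s) * exp (- b * (s - a))) (at s within {a..})"
    if "a \<le> s" for s
    by (auto intro!: derivative_eq_intros dI[OF that] simp: algebra_simps)
  have "?W t \<le> ?W a"
  proof (rule DERIV_nonpos_imp_decreasing_open[OF \<open>a \<le> t\<close>])
    show "continuous_on {a..t} ?W"
    proof (rule continuous_on_subset)
      show "continuous_on {a..} ?W"
        using dW by (intro DERIV_continuous_on) simp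
    qed auto
    fix s assume s: "a < s" "s < t"
    have "at s within {a..} = at s"
      using s by (intro at_within_interior) simp
    then have "(?W has_real_derivative b * (u s - ?V s) * exp (- b * (s - a))) (at s)"
      using dW[of s] s by simp
    moreover have "b * (u s - ?V s) * exp (- b * (s - a)) \<le> 0"
      using le[of s] s \<open>b \<ge> 0\<close> by (intro mult_nonpos_nonneg mult_nonneg_nonpos) auto
    ultimately show "\<exists>d. (?W has_real_derivative d) (at s) \<and> d \<le> 0" by blast
  qed
  then have "?W t * exp (b * (t - a)) \<le> C * exp (b * (t - a))"
    by (intro mult_right_mono) auto
  also have "?W t * exp (b * (t - a)) = ?V t"
    by (simp add: mult.assoc exp_add[symmetric])
  finally have "?V t \<le> C * exp (b * (t - a))" .
  with le[OF \<open>a \<le> t\<close>] show ?thesis by simp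
qed

lemma solves_ivp_continuous_on:
  assumes "solves_ivp F t0 \<eta> y"
  shows "continuous_on {t0..} y"
  using assms by (intro continuous_on_if_vector_derivative) (auto simp: solves_ivp_def)

lemma solves_ivp_unique:
  fixes F :: "real \<Rightarrow> 'a::banach \<Rightarrow> 'a"
  assumes y: "solves_ivp F t0 \<eta> y" and z: "solves_ivp F t0 \<eta> z"
    and lip: "\<And>t x x'. t0 \<le> t \<Longrightarrow> norm (F t x - F t x') \<le> L * norm (x - x')" and "L \<ge> 0"
    and "t0 \<le> t"
  shows "y t = z t"
proof -
  let ?u = "\<lambda>t. norm (y t - z t)"
  have cont: "continuous_on {t0..} ?u"
    by (intro continuous_intros solves_ivp_continuous_on[OF y] solves_ivp_continuous_on[OF z])
  have "?u t \<le> 0 * exp (L * (t - t0))"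
  proof (rule gronwall[OF cont \<open>L \<ge> 0\<close> _ \<open>t0 \<le> t\<close>])
    fix t assume "t0 \<le> t"
    let ?d = "\<lambda>s. F s (y s) - F s (z s)"
    have "(?d has_integral (y t - z t) - (y t0 - z t0)) {t0..t}"
    proof (rule fundamental_theorem_of_calculus[OF \<open>t0 \<le> t\<close>])
      fix s assume "s \<in> {t0..t}"
      then have "((\<lambda>t. y t - z t) has_vector_derivative ?d s) (at s within {t0..})"
        using y z by (intro has_vector_derivative_diff) (auto simp: solves_ivp_def)
      then show "((\<lambda>t. y t - z t) has_vector_derivative ?d s) (at s within {t0..t})"
        by (rule has_vector_derivative_within_subset) auto
    qed
    then have d: "(?d has_integral y t - z t) {t0..t}"
      using y z by (simp add: solves_ivp_def)
    have u: "?u integrable_on {t0..t}"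
      by (rule integrable_continuous_real) (rule continuous_on_subset[OF cont], auto)
    have "norm (integral {t0..t} ?d) \<le> integral {t0..t} (\<lambda>s. L * ?u s)"
      using lip d u by (intro integral_norm_bound_integral integrable_on_mult_right) auto
    then show "?u t \<le> 0 + L * integral {t0..t} ?u"
      using integral_unique[OF d] by simp
  qed
  then show ?thesis by simp
qed

lemma ivp_solution_eq:
  fixes F :: "real \<Rightarrow> 'a::banach \<Rightarrow> 'a"
  assumes "solves_ivp F t0 \<eta> y"
    and "\<And>t x x'. t0 \<le> t \<Longrightarrow> norm (F t x - F t x') \<le> L * norm (x - x')" and "L \<ge> 0"
    and "t0 \<le> t"
  shows "ivp_solution F t t0 \<eta> = y t"
  unfolding ivp_solution_def
proof (rule the_equality)
  show "\<exists>z. solves_ivp F t0 \<eta> z \<and> z t = y t" using assms(1) by blast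
qed (use solves_ivp_unique[OF assms(1) _ assms(2-4)] in metis)

lemma continuous_on_compose_curried:
  assumes "continuous_on (S \<times> UNIV) (\<lambda>(t, x). F t x)" "continuous_on S w"
  shows "continuous_on S (\<lambda>s. F s (w s))"
proof -
  have "continuous_on S (\<lambda>s. (s, w s))"
    by (intro continuous_on_Pair continuous_on_id assms(2))
  from continuous_on_compose2[OF assms(1) this] show ?thesis by auto
qed

text \<open>In the norm weighted by \<open>e^(2 L (t - a))\<close>, integrating a function of size \<open>L\<close> times the weight
  gains the factor 1/2. This makes the Picard operator a contraction on the whole half line.\<close>

lemma norm_integral_exp_weight_le:
  fixes g :: "real \<Rightarrow> 'a::banach"
  assumes "continuous_on {a..} g" "L > 0" "D \<ge> 0" "a \<le> t"
    and le: "\<And>s. a \<le> s \<Longrightarrow> norm (g s) \<le> L * (exp (2 * L * (s - a)) * D)"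
  shows "norm (integral {a..t} g) \<le> exp (2 * L * (t - a)) * (D / 2)"
proof -
  let ?h = "\<lambda>s. L * (exp (2 * L * (s - a)) * D)"
  let ?H = "\<lambda>s. exp (2 * L * (s - a)) * (D / 2)"
  have h: "(?h has_integral ?H t - ?H a) {a..t}"
    by (rule fundamental_theorem_of_calculus[OF \<open>a \<le> t\<close>])
      (auto intro!: derivative_eq_intros
        simp: has_real_derivative_iff_has_vector_derivative[symmetric])
  have "norm (integral {a..t} g) \<le> integral {a..t} ?h"
  proof (rule integral_norm_bound_integral)
    show "g integrable_on {a..t}"
      using assms(1) by (intro integrable_continuous_real) (auto intro: continuous_on_subset)
    show "?h integrable_on {a..t}" using h by blast
  qed (use le in auto)
  also have "\<dots> \<le> ?H t"
    using integral_unique[OF h] \<open>D \<ge> 0\<close> by simp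
  finally show ?thesis .
qed

text \<open>A solution is sought as \<open>y t = e^(2 L (t - t0)) u t\<close> with \<open>u\<close> bounded and continuous; the
  Picard operator, rewritten in terms of \<open>u\<close>, is a contraction of the Banach space of such
  functions. Clamping time at \<open>t0\<close> lets \<open>u\<close> live on all of the real line.\<close>

lemma lipschitz_ivp_solvable:
  fixes F :: "real \<Rightarrow> 'a::banach \<Rightarrow> 'a"
  assumes cont: "continuous_on ({t0..} \<times> UNIV) (\<lambda>(t, x). F t x)"
    and lip: "\<And>t x x'. t0 \<le> t \<Longrightarrow> norm (F t x - F t x') \<le> L * norm (x - x')" and "L > 0"
    and zero: "\<And>t. t0 \<le> t \<Longrightarrow> F t 0 = 0"
  obtains y where "solves_ivp F t0 \<eta> y"
proof -
  define e where "e t = exp (2 * L * (t - t0))" for t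
  have e_pos: "e t > 0" and e_ge: "t0 \<le> t \<Longrightarrow> e t \<ge> 1" for t
    using \<open>L > 0\<close> by (auto simp: e_def)
  have cont_e: "continuous_on S e" for S
    unfolding e_def by (intro continuous_intros)
  define g where "g u s = F s (e s *\<^sub>R apply_bcontfun u s)" for u :: "real \<Rightarrow>\<^sub>C 'a" and s
  define P where "P u t = \<eta> + integral {t0..t} (g u)" for u t
  define T where "T u t = (1 / e (max t0 t)) *\<^sub>R P u (max t0 t)" for u t
  have cont_g: "continuous_on {t0..} (g u)" for u
    unfolding g_def by (intro continuous_on_compose_curried[OF cont] continuous_intros cont_e) simp
  have dP: "(P u has_vector_derivative g u t) (at t within {t0..})" if "t0 \<le> t" for u t
    unfolding P_def
    by (auto intro!: derivative_eq_intros integral_has_vector_derivative_atLeast[OF cont_g that])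
  have cont_T: "continuous_on UNIV (T u)" for u
  proof -
    have "continuous_on {t0..} (\<lambda>t. (1 / e t) *\<^sub>R P u t)"
      using e_pos dP
      by (intro continuous_intros cont_e continuous_on_if_vector_derivative[where y = "P u" and y' = "g u"])
        (auto simp: less_imp_neq[symmetric])
    then show ?thesis
      unfolding T_def[abs_def]
      by (rule continuous_on_compose2) (auto intro!: continuous_intros)
  qed
  have norm_P: "norm (integral {t0..t} (g u)) \<le> e t * (norm u / 2)" if "t0 \<le> t" for u t
    unfolding e_def
  proof (rule norm_integral_exp_weight_le[OF cont_g \<open>L > 0\<close> _ that])
    fix s assume "t0 \<le> s"
    then have "norm (g u s) \<le> L * (e s * norm (apply_bcontfun u s))"
      using lip[of s "e s *\<^sub>R apply_bcontfun u s" 0] zero[of s] e_pos[of s] by (simp add: g_def)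
    also have "\<dots> \<le> L * (e s * norm u)"
      using \<open>L > 0\<close> e_pos[of s] norm_bounded[of u s] by (intro mult_left_mono) auto
    finally show "norm (g u s) \<le> L * (exp (2 * L * (s - t0)) * norm u)" by (simp add: e_def)
  qed simp
  have norm_T: "norm (T u t) \<le> norm \<eta> + norm u / 2" for u t
  proof -
    let ?t = "max t0 t"
    have "norm (P u ?t) \<le> norm \<eta> + e ?t * (norm u / 2)"
      unfolding P_def using norm_P[of ?t u] norm_triangle_ineq[of \<eta>] by (smt (verit) max.cobounded1)
    also have "\<dots> \<le> e ?t * norm \<eta> + e ?t * (norm u / 2)"
      using e_ge[of ?t] mult_right_mono[of 1 "e ?t" "norm \<eta>"] by simp
    finally show ?thesis
      using e_pos[of ?t] by (simp add: T_def field_simps)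
  qed
  define T' where "T' u = Bcontfun (T u)" for u
  have T': "apply_bcontfun (T' u) = T u" for u
  proof -
    have "bounded (range (T u))"
      using norm_T[of u] by (auto simp: bounded_iff)
    then show ?thesis
      unfolding T'_def by (intro Bcontfun_inverse) (simp add: bcontfun_def cont_T)
  qed
  have "dist (T' u) (T' v) \<le> 1 / 2 * dist u v" for u v
  proof (rule dist_bound)
    fix t
    let ?t = "max t0 t"
    have "norm (integral {t0..?t} (\<lambda>s. g u s - g v s)) \<le> e ?t * (dist u v / 2)"
      unfolding e_def
    proof (rule norm_integral_exp_weight_le[OF _ \<open>L > 0\<close>])
      show "continuous_on {t0..} (\<lambda>s. g u s - g v s)"
        by (intro continuous_intros cont_g)
      fix s assume "t0 \<le> s"
      then have "norm (g u s - g v s) \<le> L * norm (e s *\<^sub>R apply_bcontfun u s - e s *\<^sub>R apply_bcontfun v s)"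
        unfolding g_def by (rule lip)
      also have "\<dots> = L * (e s * dist (apply_bcontfun u s) (apply_bcontfun v s))"
        using e_pos[of s] by (simp add: dist_norm scaleR_diff_right[symmetric])
      also have "\<dots> \<le> L * (e s * dist u v)"
        using \<open>L > 0\<close> e_pos[of s] dist_bounded[of u s v] by (intro mult_left_mono) auto
      finally show "norm (g u s - g v s) \<le> L * (exp (2 * L * (s - t0)) * dist u v)"
        by (simp add: e_def)
    qed auto
    moreover have "g w integrable_on {t0..?t}" for w
      by (rule integrable_continuous_real) (rule continuous_on_subset[OF cont_g], auto)
    then have "P u ?t - P v ?t = integral {t0..?t} (\<lambda>s. g u s - g v s)"
      unfolding P_def by (simp add: integral_diff)
    ultimately have "norm (P u ?t - P v ?t) \<le> e ?t * (dist u v / 2)" by simp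
    then show "dist (apply_bcontfun (T' u) t) (apply_bcontfun (T' v) t) \<le> 1 / 2 * dist u v"
      using e_pos[of ?t]
      by (simp add: T' T_def dist_norm scaleR_diff_right[symmetric] divide_le_eq mult.commute)
  qed
  then obtain u where "T' u = u"
    using banach_fix_type[of "1 / 2" T'] by auto
  then have u: "e t *\<^sub>R apply_bcontfun u t = P u t" if "t0 \<le> t" for t
    using T'[of u] e_pos[of t] that by (auto simp: T_def dest: less_imp_neq)
  have "solves_ivp F t0 \<eta> (P u)"
    unfolding solves_ivp_def
  proof (intro conjI allI impI)
    show "P u t0 = \<eta>" by (simp add: P_def)
    fix t assume "t0 \<le> t"
    then have "g u t = F t (P u t)" by (simp add: g_def u)
    with dP[OF \<open>t0 \<le> t\<close>, of u] show "(P u has_vector_derivative F t (P u t)) (at t within {t0..})"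
      by simp
  qed
  then show thesis by (rule that)
qed

section \<open>Linear systems and variation of constants\<close>

lemma bounded_bilinear_matrix_mult:
  "bounded_bilinear ((**) :: real ^ 'n ^ 'm \<Rightarrow> real ^ 'p ^ 'n \<Rightarrow> real ^ 'p ^ 'm)"
  unfolding bilinear_conv_bounded_bilinear[symmetric] bilinear_def linear_iff
  by (auto simp: vec_eq_iff matrix_matrix_mult_def sum.distrib sum_distrib_left algebra_simps)

lemma bounded_bilinear_matrix_vector_mult:
  "bounded_bilinear ((*v) :: real ^ 'n ^ 'm \<Rightarrow> real ^ 'n \<Rightarrow> real ^ 'm)"
  unfolding bilinear_conv_bounded_bilinear[symmetric] bilinear_def linear_iff
  by (auto simp: vec_eq_iff matrix_vector_mult_def sum.distrib sum_distrib_left algebra_simps)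

text \<open>One statement covers \<open>A t ** X\<close>, \<open>X ** A t\<close> and \<open>A t *v x\<close>.\<close>

lemma (in bounded_bilinear) bounded_coefficient_lipschitz:
  assumes "\<And>t. t \<in> S \<Longrightarrow> norm (A t) \<le> B" "B \<ge> 0"
  shows "\<exists>L>0. \<forall>t\<in>S. \<forall>x x'. norm (prod (A t) x - prod (A t) x') \<le> L * norm (x - x')"
proof -
  obtain k where k: "k > 0" "\<And>a b. norm (prod a b) \<le> norm a * norm b * k"
    using pos_bounded by blast
  have "norm (prod (A t) x - prod (A t) x') \<le> ((B + 1) * k) * norm (x - x')" if "t \<in> S" for t x x'
  proof -
    have "norm (prod (A t) (x - x')) \<le> norm (A t) * norm (x - x') * k" by (rule k)
    also have "\<dots> \<le> (B + 1) * norm (x - x') * k"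
      using assms(1)[OF that] k(1) by (intro mult_right_mono) auto
    finally show ?thesis by (simp add: diff_right mult_ac)
  qed
  with k assms(2) show ?thesis by (intro exI[of _ "(B + 1) * k"]) auto
qed

context
  fixes A :: "real \<Rightarrow> real ^ 'n ^ 'n" and t0 B :: real
  assumes A_cont: "continuous_on {t0..} A"
    and A_bound: "\<And>t. t0 \<le> t \<Longrightarrow> norm (A t) \<le> B"
begin

lemma coefficient_bound_nonneg: "B \<ge> 0"
  using A_bound[of t0] norm_ge_zero[of "A t0"] by linarith

text \<open>\<open>X\<close> is the fundamental matrix based at \<open>t0\<close>, and \<open>Z\<close> its inverse, obtained as the fundamental
  matrix of the adjoint equation \<open>Z' = - Z A\<close>: the derivative of \<open>Z X\<close> vanishes. The factorisation of
  the transition matrix then says how it depends on its second argument.\<close>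

lemma transition_matrix_factorisation:
  obtains X Z :: "real \<Rightarrow> real ^ 'n ^ 'n" where
    "\<And>t. t0 \<le> t \<Longrightarrow> (X has_vector_derivative A t ** X t) (at t within {t0..})"
    "\<And>t. t0 \<le> t \<Longrightarrow> (Z has_vector_derivative - (Z t ** A t)) (at t within {t0..})"
    "\<And>t. t0 \<le> t \<Longrightarrow> X t ** Z t = mat 1"
    "\<And>s t. t0 \<le> s \<Longrightarrow> s \<le> t \<Longrightarrow> transition_matrix A t s = X t ** Z s"
proof -
  interpret mm: bounded_bilinear "(**) :: real ^ 'n ^ 'n \<Rightarrow> real ^ 'n ^ 'n \<Rightarrow> real ^ 'n ^ 'n"
    by (rule bounded_bilinear_matrix_mult)
  have cont_fst: "continuous_on ({t0..} \<times> UNIV) (\<lambda>p. A (fst p))"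
    by (rule continuous_on_compose2[OF A_cont]) (auto intro!: continuous_intros)
  have "\<exists>L>0. \<forall>t\<in>{t0..}. \<forall>(X :: real ^ 'n ^ 'n) Y. norm (A t ** X - A t ** Y) \<le> L * norm (X - Y)"
    by (rule mm.bounded_coefficient_lipschitz[OF _ coefficient_bound_nonneg]) (simp add: A_bound)
  then obtain L where L: "L > 0"
    "\<And>t (X :: real ^ 'n ^ 'n) Y. t \<in> {t0..} \<Longrightarrow> norm (A t ** X - A t ** Y) \<le> L * norm (X - Y)"
    by blast
  have "\<exists>L>0. \<forall>t\<in>{t0..}. \<forall>(X :: real ^ 'n ^ 'n) Y. norm (X ** A t - Y ** A t) \<le> L * norm (X - Y)"
    by (rule bounded_bilinear.bounded_coefficient_lipschitz[OF mm.flip _ coefficient_bound_nonneg])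
      (simp add: A_bound)
  then obtain L' where L': "L' > 0"
    "\<And>t (X :: real ^ 'n ^ 'n) Y. t \<in> {t0..} \<Longrightarrow> norm (X ** A t - Y ** A t) \<le> L' * norm (X - Y)"
    by blast
  obtain X :: "real \<Rightarrow> real ^ 'n ^ 'n" where X: "solves_ivp (\<lambda>t X. A t ** X) t0 (mat 1) X"
  proof (rule lipschitz_ivp_solvable[of t0 "\<lambda>t (X :: real ^ 'n ^ 'n). A t ** X" L])
    show "continuous_on ({t0..} \<times> UNIV) (\<lambda>(t, X :: real ^ 'n ^ 'n). A t ** X)"
      unfolding case_prod_beta by (intro mm.continuous_on cont_fst continuous_intros)
  qed (use L mm.zero_right in auto)
  obtain Z :: "real \<Rightarrow> real ^ 'n ^ 'n" where Z: "solves_ivp (\<lambda>t Z. - (Z ** A t)) t0 (mat 1) Z"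
  proof (rule lipschitz_ivp_solvable[of t0 "\<lambda>t (Z :: real ^ 'n ^ 'n). - (Z ** A t)" L'])
    show "continuous_on ({t0..} \<times> UNIV) (\<lambda>(t, Z :: real ^ 'n ^ 'n). - (Z ** A t))"
      unfolding case_prod_beta
      by (intro continuous_on_minus mm.continuous_on cont_fst continuous_intros)
    show "norm (- (X ** A t) - - (Y ** A t)) \<le> L' * norm (X - Y)" if "t0 \<le> t" for t and X Y :: "real ^ 'n ^ 'n"
      using L'(2)[of t Y X] that by (simp add: norm_minus_commute)
  qed (use L' mm.zero_left in auto)
  have dX: "(X has_vector_derivative A t ** X t) (at t within {t0..})" if "t0 \<le> t" for t
    using X that by (simp add: solves_ivp_def)
  have dZ: "(Z has_vector_derivative - (Z t ** A t)) (at t within {t0..})" if "t0 \<le> t" for t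
    using Z that by (simp add: solves_ivp_def)
  have "((\<lambda>t. Z t ** X t) has_vector_derivative 0) (at t within {t0..})" if "t \<in> {t0..}" for t
    using mm.has_vector_derivative[OF dZ dX] that by (simp add: matrix_mul_assoc mm.minus_left)
  then obtain C where C: "\<And>t. t \<in> {t0..} \<Longrightarrow> Z t ** X t = C"
    using has_vector_derivative_zero_constant[OF convex_real_interval(1)] by blast
  have "C = mat 1"
    using C[of t0] X Z by (simp add: solves_ivp_def)
  with C have XZ: "X t ** Z t = mat 1" if "t0 \<le> t" for t
    using that by (subst matrix_left_right_inverse) simp
  have \<Phi>: "transition_matrix A t s = X t ** Z s" if "t0 \<le> s" "s \<le> t" for s t
    unfolding transition_matrix_def
  proof (rule ivp_solution_eq[where L = L])
    show "solves_ivp (\<lambda>t X. A t ** X) s (mat 1) (\<lambda>t. X t ** Z s)"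
      unfolding solves_ivp_def
    proof (intro conjI allI impI)
      fix r assume "s \<le> r"
      with that have "(X has_vector_derivative A r ** X r) (at r within {s..})"
        by (intro has_vector_derivative_within_subset[OF dX]) auto
      from bounded_linear.has_vector_derivative[OF mm.bounded_linear_left this]
      show "((\<lambda>t. X t ** Z s) has_vector_derivative A r ** (X r ** Z s)) (at r within {s..})"
        by (simp add: matrix_mul_assoc)
    qed (use XZ that in simp)
  qed (use L that in auto)
  show thesis by (rule that[OF dX dZ XZ \<Phi>])
qed

lemma variation_of_constants:
  assumes y: "\<And>t. t0 \<le> t \<Longrightarrow> (y has_vector_derivative A t *v y t + g t) (at t within {t0..})"
    and "t0 \<le> t"
  shows "((\<lambda>s. transition_matrix A t s *v g s) has_integral
           y t - transition_matrix A t t0 *v y t0) {t0..t}"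
proof -
  interpret mv: bounded_bilinear "(*v) :: real ^ 'n ^ 'n \<Rightarrow> real ^ 'n \<Rightarrow> real ^ 'n"
    by (rule bounded_bilinear_matrix_vector_mult)
  obtain X Z :: "real \<Rightarrow> real ^ 'n ^ 'n" where "\<And>t. t0 \<le> t \<Longrightarrow> (X has_vector_derivative A t ** X t) (at t within {t0..})"
    and Z: "\<And>t. t0 \<le> t \<Longrightarrow> (Z has_vector_derivative - (Z t ** A t)) (at t within {t0..})"
    and XZ: "\<And>t. t0 \<le> t \<Longrightarrow> X t ** Z t = mat 1"
    and \<Phi>: "\<And>s t. t0 \<le> s \<Longrightarrow> s \<le> t \<Longrightarrow> transition_matrix A t s = X t ** Z s"
    using transition_matrix_factorisation by blast
  have dZy: "((\<lambda>s. Z s *v y s) has_vector_derivative Z s *v g s) (at s within {t0..})"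
    if "t0 \<le> s" for s
    using mv.has_vector_derivative[OF Z[OF that] y[OF that]]
    by (simp add: matrix_vector_mul_assoc matrix_vector_right_distrib mv.minus_left)
  have "((\<lambda>s. X t *v (Z s *v g s)) has_integral X t *v (Z t *v y t) - X t *v (Z t0 *v y t0)) {t0..t}"
  proof (rule fundamental_theorem_of_calculus[OF \<open>t0 \<le> t\<close>])
    fix s assume "s \<in> {t0..t}"
    then have "((\<lambda>s. Z s *v y s) has_vector_derivative Z s *v g s) (at s within {t0..t})"
      by (intro has_vector_derivative_within_subset[OF dZy]) auto
    from bounded_linear.has_vector_derivative[OF mv.bounded_linear_right this]
    show "((\<lambda>s. X t *v (Z s *v y s)) has_vector_derivative X t *v (Z s *v g s)) (at s within {t0..t})" .
  qed
  then have "((\<lambda>s. X t *v (Z s *v g s)) has_integral y t - transition_matrix A t t0 *v y t0) {t0..t}"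
    using \<open>t0 \<le> t\<close> by (simp add: \<Phi> XZ matrix_vector_mul_assoc)
  then show ?thesis
    by (rule has_integral_eq[rotated]) (simp add: \<Phi> matrix_vector_mul_assoc)
qed

section \<open>Exponential decay of the perturbed system\<close>

text \<open>Gronwall's inequality is applied to \<open>e^(\<alpha> (t - t0)) N (y t)\<close>, for which variation of constants
  is an integral inequality with constant coefficients.\<close>

lemma perturbed_linear_decay:
  assumes N: "is_norm N" and compat: "compatible_norms N MN"
    and \<Phi>: "\<And>s t. t0 \<le> s \<Longrightarrow> s \<le> t \<Longrightarrow> MN (transition_matrix A t s) \<le> K * exp (- \<alpha> * (t - s))"
    and "K \<ge> 0" "\<gamma> \<ge> 0"
    and f: "\<And>t x. t0 \<le> t \<Longrightarrow> N (f t x) \<le> \<gamma> * N x"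
    and y: "solves_ivp (\<lambda>t x. A t *v x + f t x) t0 \<eta> y"
    and "t0 \<le> t"
  shows "N (y t) \<le> K * exp (- (\<alpha> - K * \<gamma>) * (t - t0)) * N \<eta>"
proof -
  define u where "u t = exp (\<alpha> * (t - t0)) * N (y t)" for t
  have cont: "continuous_on {t0..} u"
    unfolding u_def
    by (intro continuous_intros
        continuous_on_compose2[OF is_norm_continuous_on[OF N, of UNIV] solves_ivp_continuous_on[OF y]])
      simp
  have \<Phi>_le: "N (transition_matrix A t s *v v) \<le> K * exp (- \<alpha> * (t - s)) * N v"
    if "t0 \<le> s" "s \<le> t" for s t v
    using compat \<Phi>[OF that] is_normD(1)[OF N, of v]
    by (meson compatible_norms_def mult_right_mono order_trans)
  have "u t \<le> (K * N \<eta>) * exp (K * \<gamma> * (t - t0))"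
  proof (rule gronwall[OF cont _ _ \<open>t0 \<le> t\<close>])
    show "0 \<le> K * \<gamma>" using \<open>K \<ge> 0\<close> \<open>\<gamma> \<ge> 0\<close> by simp
    fix t assume t: "t0 \<le> t"
    let ?E = "exp (- \<alpha> * (t - t0))"
    have "N (y t - transition_matrix A t t0 *v y t0) \<le> ?E * (K * \<gamma>) * integral {t0..t} u"
    proof (rule is_norm_has_integral_le[OF N])
      show "((\<lambda>s. transition_matrix A t s *v f s (y s)) has_integral
              y t - transition_matrix A t t0 *v y t0) {t0..t}"
        using y by (intro variation_of_constants[OF _ t]) (simp add: solves_ivp_def)
      have "u integrable_on {t0..t}"
        by (rule integrable_continuous_real) (rule continuous_on_subset[OF cont], auto)
      then show "((\<lambda>s. ?E * (K * \<gamma>) * u s) has_integral ?E * (K * \<gamma>) * integral {t0..t} u) {t0..t}"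
        by (intro has_integral_mult_right integrable_integral)
      fix s assume s: "s \<in> {t0..t}"
      have "N (transition_matrix A t s *v f s (y s)) \<le> K * exp (- \<alpha> * (t - s)) * N (f s (y s))"
        using s by (intro \<Phi>_le) auto
      also have "\<dots> \<le> K * exp (- \<alpha> * (t - s)) * (\<gamma> * N (y s))"
        using s f \<open>K \<ge> 0\<close> by (intro mult_left_mono) auto
      also have "exp (- \<alpha> * (t - s)) = ?E * exp (\<alpha> * (s - t0))"
        by (simp add: exp_add[symmetric] algebra_simps)
      finally show "N (transition_matrix A t s *v f s (y s)) \<le> ?E * (K * \<gamma>) * u s"
        by (simp add: u_def mult_ac)
    qed
    moreover have "N (transition_matrix A t t0 *v y t0) \<le> K * ?E * N \<eta>"
      using \<Phi>_le[of t0 t "y t0"] t y by (simp add: solves_ivp_def)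
    moreover have "N (y t) \<le> N (y t - transition_matrix A t t0 *v y t0) + N (transition_matrix A t t0 *v y t0)"
      using is_normD(4)[OF N, of "y t - transition_matrix A t t0 *v y t0" "transition_matrix A t t0 *v y t0"]
      by simp
    ultimately have "N (y t) \<le> ?E * (K * N \<eta> + K * \<gamma> * integral {t0..t} u)"
      by (simp add: algebra_simps)
    then have "u t \<le> exp (\<alpha> * (t - t0)) * (?E * (K * N \<eta> + K * \<gamma> * integral {t0..t} u))"
      unfolding u_def by (intro mult_left_mono) auto
    then show "u t \<le> K * N \<eta> + K * \<gamma> * integral {t0..t} u"
      by (simp add: mult.assoc[symmetric] exp_add[symmetric])
  qed
  then have "exp (- \<alpha> * (t - t0)) * u t
      \<le> exp (- \<alpha> * (t - t0)) * ((K * N \<eta>) * exp (K * \<gamma> * (t - t0)))"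
    by (intro mult_left_mono) auto
  also have "exp (- \<alpha> * (t - t0)) * u t = N (y t)"
    by (simp add: u_def mult.assoc[symmetric] exp_add[symmetric])
  also have "exp (- \<alpha> * (t - t0)) * ((K * N \<eta>) * exp (K * \<gamma> * (t - t0)))
      = K * (exp (- \<alpha> * (t - t0)) * exp (K * \<gamma> * (t - t0))) * N \<eta>"
    by (simp add: mult_ac)
  also have "\<dots> = K * exp (- (\<alpha> - K * \<gamma>) * (t - t0)) * N \<eta>"
    by (simp only: exp_add[symmetric]) (simp add: algebra_simps)
  finally show ?thesis .
qed

text \<open>The Lipschitz condition on \<open>f\<close> in \<open>N\<close> becomes one in the Euclidean norm, with \<open>\<gamma>\<close> multiplied
  by the distortion \<open>C / c\<close>; only well-posedness depends on this worse constant, the decay rate does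
  not.\<close>

lemma perturbed_linear_solution:
  assumes N: "is_norm N"
    and f_cont: "continuous_on ({t0..} \<times> UNIV) (\<lambda>(t, x). f t x)"
    and f_lip: "\<And>t x x'. t0 \<le> t \<Longrightarrow> N (f t x - f t x') \<le> \<gamma> * N (x - x')" and "\<gamma> \<ge> 0"
    and f_zero: "\<And>t. t0 \<le> t \<Longrightarrow> f t 0 = 0"
  obtains y where "solves_ivp (\<lambda>t x. A t *v x + f t x) t0 \<eta> y"
    "\<And>t. t0 \<le> t \<Longrightarrow> ivp_solution (\<lambda>t x. A t *v x + f t x) t t0 \<eta> = y t"
proof -
  interpret mv: bounded_bilinear "(*v) :: real ^ 'n ^ 'n \<Rightarrow> real ^ 'n \<Rightarrow> real ^ 'n"
    by (rule bounded_bilinear_matrix_vector_mult)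
  let ?F = "\<lambda>t x. A t *v x + f t x"
  obtain c C where c: "c > 0" "C > 0" "\<And>x. c * norm x \<le> N x" "\<And>x. N x \<le> C * norm x"
    using is_norm_equivalent[OF N] by blast
  have "\<exists>L>0. \<forall>t\<in>{t0..}. \<forall>x x'. norm (A t *v x - A t *v x') \<le> L * norm (x - x')"
    by (rule mv.bounded_coefficient_lipschitz[OF _ coefficient_bound_nonneg]) (simp add: A_bound)
  then obtain L where L: "L > 0"
    "\<And>t x x'. t \<in> {t0..} \<Longrightarrow> norm (A t *v x - A t *v x') \<le> L * norm (x - x')"
    by blast
  let ?L = "L + \<gamma> * C / c"
  have "?L > 0" using L c \<open>\<gamma> \<ge> 0\<close> by (simp add: add_pos_nonneg)
  have lip: "norm (?F t x - ?F t x') \<le> ?L * norm (x - x')" if "t0 \<le> t" for t x x'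
  proof -
    have "c * norm (f t x - f t x') \<le> \<gamma> * N (x - x')"
      using c(3) f_lip[OF that] order_trans by blast
    also have "\<dots> \<le> \<gamma> * (C * norm (x - x'))"
      using c(4) \<open>\<gamma> \<ge> 0\<close> by (rule mult_left_mono)
    finally have "norm (f t x - f t x') \<le> \<gamma> * C / c * norm (x - x')"
      using c(1) by (simp add: field_simps)
    moreover have "norm (A t *v x - A t *v x') \<le> L * norm (x - x')"
      using L(2) that by simp
    ultimately show ?thesis
      using norm_triangle_ineq[of "A t *v x - A t *v x'" "f t x - f t x'"]
      by (simp add: algebra_simps)
  qed
  obtain y where y: "solves_ivp ?F t0 \<eta> y"
  proof (rule lipschitz_ivp_solvable[OF _ lip \<open>?L > 0\<close>])
    have "continuous_on ({t0..} \<times> UNIV) (\<lambda>p. A (fst p))"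
      by (rule continuous_on_compose2[OF A_cont]) (auto intro!: continuous_intros)
    then show "continuous_on ({t0..} \<times> UNIV) (\<lambda>(t, x). ?F t x)"
      using f_cont unfolding case_prod_beta
      by (intro continuous_on_add mv.continuous_on continuous_intros)
  qed (use f_zero in auto)
  moreover have "ivp_solution ?F t t0 \<eta> = y t" if "t0 \<le> t" for t
    using ivp_solution_eq[OF y lip _ that] \<open>?L > 0\<close> by simp
  ultimately show thesis by (rule that)
qed

end

text \<open>Taking \<open>T = ln (K c / \<epsilon>) / \<beta>\<close>, or \<open>1\<close> if that is larger, makes \<open>K e^(- \<beta> T) c \<le> \<epsilon>\<close>.\<close>

lemma exponential_decay_imp_guas:
  assumes N: "is_norm N" and "K > 0" "\<beta> > 0"
    and decay: "\<And>t0 t \<eta>. 0 \<le> t0 \<Longrightarrow> t0 \<le> t \<Longrightarrow>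
      N (ivp_solution F t t0 \<eta>) \<le> K * exp (- \<beta> * (t - t0)) * N \<eta>"
  shows "origin_globally_uniformly_asymptotically_stable N F"
  unfolding origin_globally_uniformly_asymptotically_stable_def origin_uniformly_stable_def
proof (intro conjI allI impI)
  fix \<epsilon> :: real assume "\<epsilon> > 0"
  show "\<exists>\<delta>>0. \<forall>t0\<ge>0. \<forall>\<eta>. N \<eta> < \<delta> \<longrightarrow> (\<forall>t\<ge>t0. N (ivp_solution F t t0 \<eta>) < \<epsilon>)"
  proof (intro exI[of _ "\<epsilon> / K"] conjI allI impI)
    fix t0 t :: real and \<eta>
    assume *: "0 \<le> t0" "N \<eta> < \<epsilon> / K" "t0 \<le> t"
    have "N (ivp_solution F t t0 \<eta>) \<le> K * exp (- \<beta> * (t - t0)) * N \<eta>"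
      using * by (intro decay)
    also have "\<dots> \<le> K * 1 * N \<eta>"
      using * \<open>K > 0\<close> \<open>\<beta> > 0\<close> is_normD(1)[OF N] by (intro mult_right_mono mult_left_mono) auto
    also have "\<dots> < \<epsilon>"
      using *(2) \<open>K > 0\<close> by (simp add: field_simps)
    finally show "N (ivp_solution F t t0 \<eta>) < \<epsilon>" .
  qed (use \<open>\<epsilon> > 0\<close> \<open>K > 0\<close> in simp)
next
  fix \<epsilon> c :: real assume "\<epsilon> > 0" "c > 0"
  define T where "T = max 1 (ln (K * c / \<epsilon>) / \<beta>)"
  have T: "K * exp (- \<beta> * T) * c \<le> \<epsilon>"
  proof -
    have "ln (K * c / \<epsilon>) / \<beta> \<le> T"
      by (simp add: T_def)
    then have "exp (ln (K * c / \<epsilon>)) \<le> exp (\<beta> * T)"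
      using \<open>\<beta> > 0\<close> by (simp only: exp_le_cancel_iff) (simp add: field_simps)
    then have "K * c / \<epsilon> \<le> exp (\<beta> * T)"
      using \<open>\<epsilon> > 0\<close> \<open>c > 0\<close> \<open>K > 0\<close> by simp
    then show ?thesis
      using \<open>\<epsilon> > 0\<close> by (simp add: exp_minus field_simps)
  qed
  show "\<exists>T>0. \<forall>t0\<ge>0. \<forall>t>t0 + T. \<forall>\<eta>. N \<eta> < c \<longrightarrow> N (ivp_solution F t t0 \<eta>) < \<epsilon>"
  proof (intro exI[of _ T] conjI allI impI)
    show "T > 0" by (simp add: T_def)
    fix t0 t :: real and \<eta>
    assume *: "0 \<le> t0" "t0 + T < t" "N \<eta> < c"
    with \<open>T > 0\<close> have "N (ivp_solution F t t0 \<eta>) \<le> K * exp (- \<beta> * (t - t0)) * N \<eta>"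
      by (intro decay) auto
    also have "\<dots> \<le> K * exp (- \<beta> * T) * N \<eta>"
      using * \<open>K > 0\<close> \<open>\<beta> > 0\<close> is_normD(1)[OF N] by (intro mult_right_mono mult_left_mono) auto
    also have "\<dots> < K * exp (- \<beta> * T) * c"
      using * \<open>K > 0\<close> by simp
    finally show "N (ivp_solution F t t0 \<eta>) < \<epsilon>"
      using T by simp
  qed
qed

theorem lemma3:
  fixes A :: "real \<Rightarrow> real ^ 'n ^ 'n"
    and f :: "real \<Rightarrow> real ^ 'n \<Rightarrow> real ^ 'n"
    and vnorm :: "real ^ 'n \<Rightarrow> real"
    and mnorm :: "real ^ 'n ^ 'n \<Rightarrow> real"
    and M K \<alpha> \<gamma> \<mu> :: real
  assumes "is_norm vnorm" and "is_norm mnorm" and "compatible_norms vnorm mnorm"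
    and "continuous_on {0..} A"
    and "bdd_above ((\<lambda>t. mnorm (A t)) ` {0..})"
    and "(SUP t\<in>{0..}. mnorm (A t)) = M" and "M > 0"
    and "K \<ge> 1" and "\<alpha> > 0"
    and "\<And>s t. 0 \<le> s \<Longrightarrow> s \<le> t \<Longrightarrow>
           mnorm (transition_matrix A t s) \<le> K * exp (- \<alpha> * (t - s))"
    and "continuous_on ({0..} \<times> UNIV) (\<lambda>(t, y). f t y)"
    and "\<gamma> \<ge> 0" and "\<mu> \<ge> 0"
    and "\<And>t y y'. 0 \<le> t \<Longrightarrow> vnorm (f t y - f t y') \<le> \<gamma> * vnorm (y - y')"
    and "\<And>t y. 0 \<le> t \<Longrightarrow> vnorm (f t y) \<le> \<mu>"
    and "K * \<gamma> / \<alpha> < 1"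
    and "\<And>t. 0 \<le> t \<Longrightarrow> f t 0 = 0"
  shows "origin_globally_uniformly_asymptotically_stable vnorm (\<lambda>t y. A t *v y + f t y)"
proof -
  note N = assms(1) and MN = assms(2)
  have "\<alpha> > 0" "K \<ge> 1" "\<gamma> \<ge> 0" by fact+
  have "K * \<gamma> < \<alpha>" using assms(16) \<open>\<alpha> > 0\<close> by (simp add: field_simps)
  obtain c where c: "c > 0" "\<And>X. c * norm X \<le> mnorm X"
    using is_norm_equivalent[OF MN] by metis
  have A_bound: "norm (A t) \<le> M / c" if "0 \<le> t" for t
  proof -
    have "mnorm (A t) \<le> M"
      using assms(5,6) that by (auto intro: cSUP_upper)
    with c(2)[of "A t"] have "c * norm (A t) \<le> M" by simp
    with c(1) show ?thesis by (simp add: field_simps)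
  qed
  have f_le: "vnorm (f t x) \<le> \<gamma> * vnorm x" if "0 \<le> t" for t x
    using assms(14)[OF that, of x 0] assms(17)[OF that] by simp
  show ?thesis
  proof (rule exponential_decay_imp_guas[OF N])
    show "K > 0" "\<alpha> - K * \<gamma> > 0" using \<open>K \<ge> 1\<close> \<open>K * \<gamma> < \<alpha>\<close> by auto
    fix t0 t :: real and \<eta> :: "real ^ 'n"
    assume t: "0 \<le> t0" "t0 \<le> t"
    have A_cont: "continuous_on {t0..} A"
      using t by (intro continuous_on_subset[OF assms(4)]) auto
    obtain y where y: "solves_ivp (\<lambda>t x. A t *v x + f t x) t0 \<eta> y"
      "ivp_solution (\<lambda>t x. A t *v x + f t x) t t0 \<eta> = y t"
    proof (rule perturbed_linear_solution[OF A_cont _ N, of "M / c" f \<gamma> \<eta>])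
      show "continuous_on ({t0..} \<times> UNIV) (\<lambda>(t, x). f t x)"
        using t by (intro continuous_on_subset[OF assms(11)]) auto
    qed (use A_bound assms(14,17) \<open>\<gamma> \<ge> 0\<close> t in auto)
    have "vnorm (y t) \<le> K * exp (- (\<alpha> - K * \<gamma>) * (t - t0)) * vnorm \<eta>"
      by (rule perturbed_linear_decay[where B = "M / c", OF A_cont _ N assms(3) _ _ _ _ y(1)])
        (use A_bound assms(10) f_le \<open>\<gamma> \<ge> 0\<close> \<open>K \<ge> 1\<close> t in auto)
    then show "vnorm (ivp_solution (\<lambda>t y. A t *v y + f t y) t t0 \<eta>)
        \<le> K * exp (- (\<alpha> - K * \<gamma>) * (t - t0)) * vnorm \<eta>"
      by (simp add: y(2))
  qed
qed

end
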